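(* There is an absolute constant $C>0$ such that for every integer $n\ge 3$ the following hold. (i) $$E_n^{(0)}I_n=\frac{n(n-1)}4+\frac16n+\frac1{12}+\frac{\frac{(-1)^n}{n!}}{\sum_{l=0}^n\frac{(-1)^l}{l!}}\left(\frac{n-1}{12}\right),$$ and consequently $E_n^{(0)}I_n=\frac{n(n-1)}4+\frac16n+\frac1{12}+O\left(\frac1{(n-1)!}\right)$, that is, $$\left|E_n^{(0)}I_n-\frac{n(n-1)}4-\frac16n-\frac1{12}\right|\le \frac{C}{(n-1)!}.$$ (ii) For all integers $i,j$ with $1\le i<j\le n$, $$P_n^{(0)}(\sigma^{-1}_i<\sigma^{-1}_j)=\frac12+\frac{\big(1-2(j-i)\big)n+2(j-i)}{2n(n-1)(n-2)}+\frac{\frac{(-1)^n}{n!}}{\sum_{l=0}^n\frac{(-1)^l}{l!}}\cdot\frac{2(j-i)-n}{2n(n-2)},$$ and consequently $P_n^{(0)}(\sigma^{-1}_i<\sigma^{-1}_j)=\frac12+\frac{(1-2(j-i))n+2(j-i)}{2n(n-1)(n-2)}+O\left(\frac1{(n+1)!}\right)$, that is, $$\left|P_n^{(0)}(\sigma^{-1}_i<\sigma^{-1}_j)-\frac12-\frac{\big(1-2(j-i)\big)n+2(j-i)}{2n(n-1)(n-2)}\right|\le \frac{C}{(n+1)!}.$$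
   Context: Let $[n]=\{1,\dots,n\}$ and let $S_n$ be the set of permutations of $[n]$, written in one-line notation as $\sigma=\sigma_1\cdots\sigma_n$. For $i\in[n]$, $\sigma^{-1}_i$ denotes the position of the number $i$ in $\sigma$ (the value of the inverse permutation at $i$). The number of inversions of $\sigma\in S_n$ is $$I_n(\sigma)=\sum_{1\le i<j\le n}1_{\{\sigma_j<\sigma_i\}}=\sum_{1\le i<j\le n}1_{\{\sigma^{-1}_j<\sigma^{-1}_i\}}.$$ A permutation $\sigma\in S_n$ is a derangement if $\sigma_i\ne i$ for all $i\in[n]$. Let $D_n\subset S_n$ be the set of derangements, let $P_n^{(0)}$ be the uniform probability measure on $D_n$, and let $E_n^{(0)}$ be the expectation with respect to $P_n^{(0)}$. *)

theory Defs
  imports "HOL-Probability.Probability" "HOL-Combinatorics.Permutations"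
begin

definition derangements :: "nat \<Rightarrow> (nat \<Rightarrow> nat) set" where
  "derangements n = {\<sigma>. \<sigma> permutes {1..n} \<and> (\<forall>i\<in>{1..n}. \<sigma> i \<noteq> i)}"

definition inversions :: "nat \<Rightarrow> (nat \<Rightarrow> nat) \<Rightarrow> nat" where
  "inversions n \<sigma> = (\<Sum>(i, j)\<in>{(i, j). 1 \<le> i \<and> i < j \<and> j \<le> n}. of_bool (\<sigma> j < \<sigma> i))"

(* pmf_of_set is the uniform distribution only on a finite nonempty set; derangements n is
   always finite, and it is empty exactly for n = 1. *)
definition derangement_pmf :: "nat \<Rightarrow> (nat \<Rightarrow> nat) pmf" where
  "derangement_pmf n = pmf_of_set (derangements n)"

definition derangement_ratio :: "nat \<Rightarrow> real" where
  "derangement_ratio n = ((- 1) ^ n / fact n) / (\<Sum>l = 0..n. (- 1) ^ l / fact l)"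

end

theory Submission
  imports Defs
begin

text \<open>
  Since inversion preserves derangements, the event concerns the order of \<open>\<tau> i\<close> and \<open>\<tau> j\<close> for a
  uniform derangement \<open>\<tau>\<close>. Composing \<open>\<tau>\<close> with the transposition of \<open>i\<close> and \<open>j\<close> reverses
  that order and yields a derangement again unless \<open>\<tau> i = j\<close> or \<open>\<tau> j = i\<close>; so only these exceptional
  cases deviate from probability 1/2. If \<open>\<tau> i = j\<close> and \<open>\<tau> j \<noteq> i\<close>, removing \<open>j\<close> from its cycle
  leaves a derangement of \<open>n - 1\<close> points, and by conjugation the value \<open>\<tau> j\<close> is equidistributed over
  the remaining \<open>n - 2\<close> points. The probability is affine in \<open>j - i\<close>, and summing it over all pairs
  gives the expected number of inversions.
\<close>

section \<open>Derangements of an arbitrary set, so that points can be deleted\<close>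

definition derange :: "'a set \<Rightarrow> ('a \<Rightarrow> 'a) set" where
  "derange S = {\<tau>. \<tau> permutes S \<and> (\<forall>x\<in>S. \<tau> x \<noteq> x)}"

lemma finite_derange: "finite S \<Longrightarrow> finite (derange S)"
  unfolding derange_def by (rule finite_subset[OF _ finite_permutations[of S]]) auto

lemma derange_permutes: "\<tau> \<in> derange S \<Longrightarrow> \<tau> permutes S"
  by (simp add: derange_def)

lemma derange_neq: "\<tau> \<in> derange S \<Longrightarrow> x \<in> S \<Longrightarrow> \<tau> x \<noteq> x"
  by (simp add: derange_def)

lemma derange_in: "\<tau> \<in> derange S \<Longrightarrow> x \<in> S \<Longrightarrow> \<tau> x \<in> S"
  by (simp add: derange_def permutes_in_image)

lemma derange_eq_iff: "\<tau> \<in> derange S \<Longrightarrow> \<tau> x = \<tau> y \<longleftrightarrow> x = y"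
  by (auto simp: derange_def dest: permutes_inj injD)

lemma derange_inv: "\<tau> \<in> derange S \<Longrightarrow> inv \<tau> \<in> derange S"
  unfolding derange_def by (auto simp: permutes_inv) (metis permutes_inv_eq)

text \<open>Conjugation moves fixed points by the transposition: a fixed point \<open>x\<close> of
  the conjugate would make \<open>Transposition.transpose b c x\<close> a fixed point of
  \<open>\<tau>\<close>.\<close>

lemma derange_conj:
  assumes "\<tau> \<in> derange S" "b \<in> S" "c \<in> S"
  shows "Transposition.transpose b c \<circ> \<tau> \<circ> Transposition.transpose b c \<in> derange S"
proof -
  have t: "Transposition.transpose b c permutes S"
    using assms by (simp add: permutes_swap_id)
  have "Transposition.transpose b c \<circ> \<tau> \<circ> Transposition.transpose b c permutes S"
    using t derange_permutes[OF assms(1)] by (intro permutes_compose)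
  moreover have "(Transposition.transpose b c \<circ> \<tau> \<circ> Transposition.transpose b c) x \<noteq> x" if "x \<in> S" for x
  proof
    assume "(Transposition.transpose b c \<circ> \<tau> \<circ> Transposition.transpose b c) x = x"
    then have "\<tau> (Transposition.transpose b c x) = Transposition.transpose b c x"
      by (metis comp_apply transpose_involutory)
    moreover have "Transposition.transpose b c x \<in> S"
      using t that by (simp add: permutes_in_image)
    ultimately show False
      using derange_neq[OF assms(1)] by blast
  qed
  ultimately show ?thesis
    by (simp add: derange_def)
qed

section \<open>Derangements with one or two prescribed values\<close>

lemma card_derange_value_eq:
  assumes "b \<in> S" "c \<in> S" "i \<noteq> b" "i \<noteq> c"
  shows "card {\<tau> \<in> derange S. \<tau> i = b} = card {\<tau> \<in> derange S. \<tau> i = c}"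
proof (rule bij_betw_same_card)
  \<comment> \<open>Conjugation is an involution on derangements. The transposition fixes
    \<open>i\<close>, so the conjugate sends \<open>i\<close> to the transposed value of
    \<open>\<tau> i\<close>, which exchanges the two conditions.\<close>
  let ?f = "\<lambda>\<tau>. Transposition.transpose b c \<circ> \<tau> \<circ> Transposition.transpose b c"
  show "bij_betw ?f {\<tau> \<in> derange S. \<tau> i = b} {\<tau> \<in> derange S. \<tau> i = c}"
    by (rule bij_betw_byWitness[where f' = ?f])
      (use assms in \<open>auto simp: derange_conj fun_eq_iff\<close>)
qed

text \<open>The derangements are partitioned by their value at \<open>i\<close>, which can be any
  point of \<open>S\<close> except \<open>i\<close>, and all these classes are equally large. The
  product form avoids division of natural numbers.\<close>

lemma card_derange_value:
  assumes "finite S" "i \<in> S" "b \<in> S" "i \<noteq> b"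
  shows "(card S - 1) * card {\<tau> \<in> derange S. \<tau> i = b} = card (derange S)"
proof -
  have "derange S = (\<Union>c\<in>S - {i}. {\<tau> \<in> derange S. \<tau> i = c})"
    using assms(2) derange_in derange_neq by fastforce
  then have "card (derange S) = card (\<Union>c\<in>S - {i}. {\<tau> \<in> derange S. \<tau> i = c})"
    by (rule arg_cong)
  also have "\<dots> = (\<Sum>c\<in>S - {i}. card {\<tau> \<in> derange S. \<tau> i = c})"
    using assms(1) by (intro card_UN_disjoint) (auto simp: finite_derange)
  also have "\<dots> = (\<Sum>c\<in>S - {i}. card {\<tau> \<in> derange S. \<tau> i = b})"
    using assms by (intro sum.cong refl card_derange_value_eq) auto
  finally show ?thesis
    using assms by simp
qed

text \<open>Shortcutting the path from \<open>i\<close> through \<open>j\<close> to \<open>b\<close>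
  makes \<open>j\<close> a fixed point, which can then be dropped. Left composition with the
  transposition of \<open>j\<close> and \<open>b\<close> performs the shortcut, and being an
  involution it also undoes it. As \<open>b\<close> differs from \<open>i\<close>, the shortcut does
  not turn \<open>i\<close> into a fixed point.\<close>

lemma card_derange_path:
  assumes "i \<in> S" "j \<in> S" "b \<in> S" "i \<noteq> j" "b \<noteq> i" "b \<noteq> j"
  shows "card {\<tau> \<in> derange S. \<tau> i = j \<and> \<tau> j = b} = card {\<tau> \<in> derange (S - {j}). \<tau> i = b}"
proof (rule bij_betw_same_card)
  let ?f = "\<lambda>\<tau>. Transposition.transpose j b \<circ> \<tau>"
  have t: "Transposition.transpose j b permutes S"
    using assms by (simp add: permutes_swap_id)
  have 1: "?f \<tau> \<in> derange (S - {j})" if \<tau>: "\<tau> \<in> derange S" "\<tau> i = j" "\<tau> j = b" for \<tau>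
  proof -
    have "?f \<tau> permutes S"
      using t derange_permutes[OF \<tau>(1)] by (intro permutes_compose)
    moreover have "?f \<tau> j = j"
      by (simp add: \<tau>(3))
    ultimately have "?f \<tau> permutes S - {j}"
      by - (rule permutes_superset, auto)
    moreover have "?f \<tau> x \<noteq> x" if "x \<in> S - {j}" for x
    proof (cases "x = i")
      case True
      then show ?thesis
        using \<tau>(2) assms(5) by simp
    next
      case False
      then have "\<tau> x \<noteq> j" "\<tau> x \<noteq> b"
        using that \<tau>(2,3) derange_eq_iff[OF \<tau>(1), of x i] derange_eq_iff[OF \<tau>(1), of x j]
        by simp_all
      then show ?thesis
        using that derange_neq[OF \<tau>(1)] by simp
    qed
    ultimately show ?thesis
      by (simp add: derange_def)
  qed
  \<comment> \<open>The reverse direction inserts \<open>j\<close> between \<open>i\<close> and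
    \<open>b\<close>. The function \<open>\<tau>\<close> is the identity outside
    \<open>S - {j}\<close>, so it fixes \<open>j\<close> before the insertion.\<close>
  have 2: "?f \<tau> \<in> derange S" "\<tau> j = j" if \<tau>: "\<tau> \<in> derange (S - {j})" "\<tau> i = b" for \<tau>
  proof -
    show fx: "\<tau> j = j"
      using derange_permutes[OF \<tau>(1)] by (simp add: permutes_not_in)
    have "\<tau> permutes S"
      using derange_permutes[OF \<tau>(1)] by (rule permutes_subset) auto
    then have "?f \<tau> permutes S"
      using t by (intro permutes_compose)
    moreover have "?f \<tau> x \<noteq> x" if "x \<in> S" for x
    proof (cases "x = i \<or> x = j")
      case True
      then show ?thesis
        using \<tau>(2) assms(4,6) fx by auto
    next
      case False
      then have "\<tau> x \<noteq> j" "\<tau> x \<noteq> b"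
        using \<tau>(2) fx derange_eq_iff[OF \<tau>(1), of x i] derange_eq_iff[OF \<tau>(1), of x j]
        by simp_all
      then show ?thesis
        using False that derange_neq[OF \<tau>(1)] by simp
    qed
    ultimately show "?f \<tau> \<in> derange S"
      by (simp add: derange_def)
  qed
  let ?A = "{\<tau> \<in> derange S. \<tau> i = j \<and> \<tau> j = b}" and ?B = "{\<tau> \<in> derange (S - {j}). \<tau> i = b}"
  have "?f (?f \<tau>) = \<tau>" for \<tau>
    by (simp add: fun_eq_iff)
  moreover have "?f ` ?A \<subseteq> ?B"
    by (rule image_subsetI) (simp add: 1)
  moreover have "?f ` ?B \<subseteq> ?A"
    by (rule image_subsetI) (simp add: 2)
  ultimately show "bij_betw ?f ?A ?B"
    by (intro bij_betw_byWitness[where f' = ?f]) blast+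
qed

text \<open>The transposition cancels the 2-cycle, leaving both points fixed and every other value
  unchanged; composing again restores the cycle.\<close>

lemma card_derange_2cycle:
  assumes "i \<in> S" "j \<in> S" "i \<noteq> j"
  shows "card {\<tau> \<in> derange S. \<tau> i = j \<and> \<tau> j = i} = card (derange (S - {i, j}))"
proof (rule bij_betw_same_card)
  let ?f = "\<lambda>\<tau>. Transposition.transpose i j \<circ> \<tau>"
  have t: "Transposition.transpose i j permutes S"
    using assms by (simp add: permutes_swap_id)
  have 1: "?f \<tau> \<in> derange (S - {i, j})" if \<tau>: "\<tau> \<in> derange S" "\<tau> i = j" "\<tau> j = i" for \<tau>
  proof -
    have "?f \<tau> permutes S"
      using t derange_permutes[OF \<tau>(1)] by (intro permutes_compose)
    moreover have "?f \<tau> i = i" "?f \<tau> j = j"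
      by (simp_all add: \<tau>(2,3))
    ultimately have "?f \<tau> permutes S - {i, j}"
      by - (rule permutes_superset, auto)
    moreover have "?f \<tau> x \<noteq> x" if "x \<in> S - {i, j}" for x
    proof -
      have "\<tau> x \<noteq> i" "\<tau> x \<noteq> j"
        using that \<tau>(2,3) derange_eq_iff[OF \<tau>(1), of x i] derange_eq_iff[OF \<tau>(1), of x j]
        by simp_all
      then show ?thesis
        using that derange_neq[OF \<tau>(1)] by simp
    qed
    ultimately show ?thesis
      by (simp add: derange_def)
  qed
  have 2: "?f \<tau> \<in> derange S" "\<tau> i = i" "\<tau> j = j" if \<tau>: "\<tau> \<in> derange (S - {i, j})" for \<tau>
  proof -
    show fx: "\<tau> i = i" "\<tau> j = j"
      using derange_permutes[OF \<tau>(1)] by (simp_all add: permutes_not_in)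
    have "\<tau> permutes S"
      using derange_permutes[OF \<tau>(1)] by (rule permutes_subset) auto
    then have "?f \<tau> permutes S"
      using t by (intro permutes_compose)
    moreover have "?f \<tau> x \<noteq> x" if "x \<in> S" for x
    proof (cases "x = i \<or> x = j")
      case True
      then show ?thesis
        using assms(3) fx by auto
    next
      case False
      then have "\<tau> x \<noteq> i" "\<tau> x \<noteq> j"
        using fx derange_eq_iff[OF \<tau>(1), of x i] derange_eq_iff[OF \<tau>(1), of x j]
        by simp_all
      then show ?thesis
        using False that derange_neq[OF \<tau>(1)] by simp
    qed
    ultimately show "?f \<tau> \<in> derange S"
      by (simp add: derange_def)
  qed
  let ?A = "{\<tau> \<in> derange S. \<tau> i = j \<and> \<tau> j = i}" and ?B = "derange (S - {i, j})"
  have "?f (?f \<tau>) = \<tau>" for \<tau>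
    by (simp add: fun_eq_iff)
  moreover have "?f ` ?A \<subseteq> ?B"
    by (rule image_subsetI) (simp add: 1)
  moreover have "?f ` ?B \<subseteq> ?A"
    by (rule image_subsetI) (simp add: 2)
  ultimately show "bij_betw ?f ?A ?B"
    by (intro bij_betw_byWitness[where f' = ?f]) blast+
qed

text \<open>Split on the value \<open>b\<close> of \<open>\<tau> j\<close>. For \<open>b = i\<close>
  there is a 2-cycle to delete; every other \<open>b\<close> gives a path to shortcut, and the
  resulting classes together exhaust the derangements of \<open>S - {j}\<close>.\<close>

lemma card_derange_value_rec:
  assumes "finite S" "i \<in> S" "j \<in> S" "i \<noteq> j"
  shows "card {\<tau> \<in> derange S. \<tau> i = j} = card (derange (S - {j})) + card (derange (S - {i, j}))"
proof -
  let ?P = "\<lambda>b. {\<tau> \<in> derange S. \<tau> i = j \<and> \<tau> j = b}"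
  have "{\<tau> \<in> derange S. \<tau> i = j} = ?P i \<union> (\<Union>b\<in>S - {i, j}. ?P b)"
    using assms derange_in derange_neq by fastforce
  also have "card \<dots> = card (?P i) + card (\<Union>b\<in>S - {i, j}. ?P b)"
    using assms(1) by (intro card_Un_disjoint) (auto simp: finite_derange)
  also have "card (\<Union>b\<in>S - {i, j}. ?P b) = (\<Sum>b\<in>S - {i, j}. card (?P b))"
    using assms(1) by (intro card_UN_disjoint) (auto simp: finite_derange)
  also have "\<dots> = (\<Sum>b\<in>S - {i, j}. card {\<tau> \<in> derange (S - {j}). \<tau> i = b})"
    using assms by (intro sum.cong refl card_derange_path) auto
  \<comment> \<open>The sum is read backwards as a partition of \<open>derange (S - {j})\<close> by
    the value at \<open>i\<close>.\<close>
  also have "\<dots> = card (\<Union>b\<in>S - {i, j}. {\<tau> \<in> derange (S - {j}). \<tau> i = b})"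
    using assms(1) by (intro card_UN_disjoint[symmetric]) (auto simp: finite_derange)
  also have "(\<Union>b\<in>S - {i, j}. {\<tau> \<in> derange (S - {j}). \<tau> i = b}) = derange (S - {j})"
    using assms derange_in[of _ "S - {j}" i] derange_neq[of _ "S - {j}" i] by auto
  finally show ?thesis
    using card_derange_2cycle[OF assms(2-4)] by simp
qed

section \<open>Derangement numbers, given by the two-term recurrence that deletion of points
  yields\<close>

fun subfactorial :: "nat \<Rightarrow> nat" where
  "subfactorial 0 = 1"
| "subfactorial (Suc 0) = 0"
| "subfactorial (Suc (Suc n)) = Suc n * (subfactorial (Suc n) + subfactorial n)"

text \<open>Fix a point \<open>i\<close>. With \<open>Suc (Suc n)\<close> points there are
  \<open>Suc n\<close> equally frequent values at \<open>i\<close>, and the count for one value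
  splits into derangements of \<open>Suc n\<close> and of \<open>n\<close> points.\<close>

lemma card_derange: "finite S \<Longrightarrow> card (derange S) = subfactorial (card S)"
proof (induction "card S" arbitrary: S rule: subfactorial.induct)
  case 1
  then show ?case by (simp add: derange_def)
next
  case 2
  then obtain x where "S = {x}"
    by (metis One_nat_def card_1_singletonE)
  then have "derange S = {}"
    using derange_in derange_neq by fastforce
  then show ?case using 2 by (metis card.empty subfactorial.simps(2))
next
  case (3 n)
  obtain i T where T: "S = insert i T" "i \<notin> T" "card T = Suc n"
    using 3(3) by (metis card_Suc_eq)
  then obtain j where j: "j \<in> T"
    by fastforce
  have c: "card (S - {j}) = Suc n" "card (S - {i, j}) = n"
    using T j \<open>finite S\<close> by (auto simp: card_Diff_subset)
  have "card (derange S) = (card S - 1) * card {\<tau> \<in> derange S. \<tau> i = j}"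
    using T j \<open>finite S\<close> by (intro card_derange_value[symmetric]) auto
  also have "card {\<tau> \<in> derange S. \<tau> i = j} = card (derange (S - {j})) + card (derange (S - {i, j}))"
    using T j \<open>finite S\<close> by (intro card_derange_value_rec) auto
  also have "card (derange (S - {j})) = subfactorial (Suc n)"
    using 3(1)[of "S - {j}"] c \<open>finite S\<close> by simp
  also have "card (derange (S - {i, j})) = subfactorial n"
    using 3(2)[of "S - {i, j}"] c \<open>finite S\<close> by simp
  finally show ?case
    unfolding 3(3)[symmetric] by simp
qed

text \<open>Writing D(k) for \<open>subfactorial k\<close>, the two-term recurrence says D(n+2) -
  (n+2) D(n+1) = -(D(n+1) - (n+1) D(n)), so this difference only changes sign at each step.\<close>

lemma subfactorial_Suc: "real (subfactorial (Suc n)) = real (Suc n) * subfactorial n + (-1) ^ Suc n"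
  by (induction n) (auto simp: algebra_simps)

text \<open>Divided by the factorial, the one-term recurrence adds exactly the next term of the
  alternating sum.\<close>

lemma subfactorial_eq_sum: "real (subfactorial n) = fact n * (\<Sum>l = 0..n. (-1) ^ l / fact l)"
proof (induction n)
  case (Suc n)
  have "fact (Suc n) * ((-1) ^ Suc n / fact (Suc n)) = (-1 :: real) ^ Suc n"
    by (metis fact_nonzero nonzero_mult_div_cancel_left times_divide_eq_right)
  with Suc show ?case
    unfolding subfactorial_Suc sum.atLeast0_atMost_Suc distrib_left by simp
qed simp

lemma derangement_ratio_eq: "derangement_ratio n = (-1) ^ n / subfactorial n"
  by (simp add: derangement_ratio_def subfactorial_eq_sum)

section \<open>Counting derangements by the order of two values\<close>

lemma card_derange_swap:
  fixes i j :: "'a :: linorder"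
  assumes "finite S" "i \<in> S" "j \<in> S" "i \<noteq> j"
  shows "2 * card {\<tau> \<in> derange S. \<tau> i \<noteq> j \<and> \<tau> j \<noteq> i \<and> \<tau> i < \<tau> j} =
    card {\<tau> \<in> derange S. \<tau> i \<noteq> j \<and> \<tau> j \<noteq> i}"
proof -
  let ?A = "{\<tau> \<in> derange S. \<tau> i \<noteq> j \<and> \<tau> j \<noteq> i}"
  let ?f = "\<lambda>\<tau>. \<tau> \<circ> Transposition.transpose i j"
  have t: "Transposition.transpose i j permutes S"
    using assms by (simp add: permutes_swap_id)
  have f: "?f \<tau> \<in> ?A" if \<tau>: "\<tau> \<in> ?A" for \<tau>
  proof -
    have "?f \<tau> permutes S"
      using t \<tau> derange_permutes[of \<tau>] by (intro permutes_compose) auto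
    \<comment> \<open>Only the values at \<open>i\<close> and \<open>j\<close> are exchanged, so a
      new fixed point would need \<open>\<tau> j = i\<close> or \<open>\<tau> i = j\<close>, both
      excluded in \<open>?A\<close>.\<close>
    moreover have "?f \<tau> x \<noteq> x" if "x \<in> S" for x
      using that \<tau> derange_neq[of \<tau> S]
      by (cases "x = i"; cases "x = j") (auto simp: Transposition.transpose_def)
    ultimately show ?thesis
      using \<tau> assms derange_neq[of \<tau> S] by (auto simp: derange_def)
  qed
  \<comment> \<open>The exchange reverses the order of the two values, which are distinct by
    injectivity; hence each order accounts for half of \<open>?A\<close>.\<close>
  have "bij_betw ?f {\<tau> \<in> ?A. \<tau> i < \<tau> j} {\<tau> \<in> ?A. \<tau> j < \<tau> i}"
    by (rule bij_betw_byWitness[where f' = ?f])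
      (use f in \<open>auto simp: fun_eq_iff\<close>)
  then have "card {\<tau> \<in> ?A. \<tau> i < \<tau> j} = card {\<tau> \<in> ?A. \<tau> j < \<tau> i}"
    by (rule bij_betw_same_card)
  moreover have "?A = {\<tau> \<in> ?A. \<tau> i < \<tau> j} \<union> {\<tau> \<in> ?A. \<tau> j < \<tau> i}"
  proof -
    have "\<tau> i < \<tau> j \<or> \<tau> j < \<tau> i" if "\<tau> \<in> ?A" for \<tau>
      using that assms derange_eq_iff[of \<tau> S i j] by auto
    then show ?thesis by blast
  qed
  then have "card ?A = card ({\<tau> \<in> ?A. \<tau> i < \<tau> j} \<union> {\<tau> \<in> ?A. \<tau> j < \<tau> i})"
    by (rule arg_cong)
  moreover have "card ({\<tau> \<in> ?A. \<tau> i < \<tau> j} \<union> {\<tau> \<in> ?A. \<tau> j < \<tau> i}) =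
      card {\<tau> \<in> ?A. \<tau> i < \<tau> j} + card {\<tau> \<in> ?A. \<tau> j < \<tau> i}"
    by (intro card_Un_disjoint) (auto simp: assms(1) finite_derange)
  ultimately show ?thesis
    by (simp add: conj_assoc)
qed

text \<open>Inclusion-exclusion for the two exceptional events, whose intersection is the 2-cycle
  case. The additive form avoids truncated subtraction.\<close>

lemma card_derange_avoid:
  assumes "finite S" "i \<in> S" "j \<in> S" "i \<noteq> j"
  shows "card {\<tau> \<in> derange S. \<tau> i \<noteq> j \<and> \<tau> j \<noteq> i} + card {\<tau> \<in> derange S. \<tau> i = j}
      + card {\<tau> \<in> derange S. \<tau> j = i} = card (derange S) + card (derange (S - {i, j}))"
proof -
  let ?A = "{\<tau> \<in> derange S. \<tau> i \<noteq> j \<and> \<tau> j \<noteq> i}"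
  let ?B = "{\<tau> \<in> derange S. \<tau> i = j}" and ?C = "{\<tau> \<in> derange S. \<tau> j = i}"
  have fin: "finite (derange S)"
    by (simp add: assms(1) finite_derange)
  have "derange S = ?A \<union> (?B \<union> ?C)"
    by auto
  then have "card (derange S) = card (?A \<union> (?B \<union> ?C))"
    by (rule arg_cong)
  also have "\<dots> = card ?A + card (?B \<union> ?C)"
    using fin by (intro card_Un_disjoint) auto
  finally have "card (derange S) = card ?A + card (?B \<union> ?C)" .
  moreover have "card ?B + card ?C = card (?B \<union> ?C) + card (?B \<inter> ?C)"
    using fin by (intro card_Un_Int) auto
  moreover have "?B \<inter> ?C = {\<tau> \<in> derange S. \<tau> i = j \<and> \<tau> j = i}"
    by auto
  ultimately show ?thesis
    using card_derange_2cycle[OF assms(2-4)] by simp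
qed

text \<open>After \<open>j\<close> is deleted, \<open>b\<close> is one of the
  \<open>card S - 2\<close> equally frequent values at \<open>i\<close> of a derangement on
  \<open>card S - 1\<close> points.\<close>

lemma card_derange_path_value:
  assumes "finite S" "i \<in> S" "j \<in> S" "b \<in> S" "i \<noteq> j" "b \<noteq> i" "b \<noteq> j"
  shows "(card S - 2) * card {\<tau> \<in> derange S. \<tau> i = j \<and> \<tau> j = b} = subfactorial (card S - 1)"
proof -
  have "(card (S - {j}) - 1) * card {\<tau> \<in> derange (S - {j}). \<tau> i = b} = card (derange (S - {j}))"
    using assms by (intro card_derange_value) auto
  then show ?thesis
    using assms by (simp add: card_derange_path card_derange numeral_2_eq_2)
qed

lemma card_derange_path_set:
  assumes "finite S" "i \<in> S" "j \<in> S" "i \<noteq> j" "B \<subseteq> S - {i, j}"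
  shows "(card S - 2) * card {\<tau> \<in> derange S. \<tau> i = j \<and> \<tau> j \<in> B}
    = card B * subfactorial (card S - 1)"
proof -
  have "finite B"
    using assms finite_subset by blast
  have "{\<tau> \<in> derange S. \<tau> i = j \<and> \<tau> j \<in> B} = (\<Union>b\<in>B. {\<tau> \<in> derange S. \<tau> i = j \<and> \<tau> j = b})"
    by auto
  also have "card \<dots> = (\<Sum>b\<in>B. card {\<tau> \<in> derange S. \<tau> i = j \<and> \<tau> j = b})"
    using assms(1) \<open>finite B\<close> by (intro card_UN_disjoint) (auto simp: finite_derange)
  also have "(card S - 2) * \<dots> = (\<Sum>b\<in>B. subfactorial (card S - 1))"
    unfolding sum_distrib_left using assms by (intro sum.cong refl card_derange_path_value) auto
  finally show ?thesis by simp
qed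

text \<open>The non-exceptional derangements contribute half of their number. If
  \<open>\<tau> i = j\<close>, the order requires one of the \<open>n - j\<close> values above
  \<open>j\<close> at \<open>j\<close>; if \<open>\<tau> j = i\<close>, it requires one of the
  \<open>i - 1\<close> values below \<open>i\<close> at \<open>i\<close>. Since these numbers add up
  to \<open>n - 1 - (j - i)\<close>, only the distance \<open>j - i\<close> matters.\<close>

lemma card_derange_less:
  assumes "1 \<le> i" "i < j" "j \<le> n" "n \<ge> 3"
  shows "real (card {\<tau> \<in> derange {1..n}. \<tau> i < \<tau> j}) =
    (real (subfactorial n) - real (subfactorial (n - 2))) / 2
    + (1 - (real j - real i)) * real (subfactorial (n - 1)) / (real n - 2)"
proof -
  let ?S = "{1..n}"
  let ?A = "{\<tau> \<in> derange ?S. \<tau> i \<noteq> j \<and> \<tau> j \<noteq> i \<and> \<tau> i < \<tau> j}"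
  let ?B = "{\<tau> \<in> derange ?S. \<tau> i = j \<and> \<tau> j \<in> {j<..n}}"
  let ?C = "{\<tau> \<in> derange ?S. \<tau> j = i \<and> \<tau> i \<in> {1..<i}}"
  have S: "i \<in> ?S" "j \<in> ?S" "i \<noteq> j" "j \<noteq> i" "finite ?S"
    using assms by auto
  have fin: "finite (derange ?S)"
    by (simp add: finite_derange)
  have c: "card (?S - {i, j}) = n - 2" "card (?S - {j}) = n - 1" "card (?S - {i}) = n - 1"
    using S by (auto simp: card_Diff_subset)
  \<comment> \<open>The 2-cycle case, where \<open>\<tau> i = j\<close> and
    \<open>\<tau> j = i\<close>, belongs to none of the three sets because
    \<open>i < j\<close>.\<close>
  have split: "{\<tau> \<in> derange ?S. \<tau> i < \<tau> j} = ?A \<union> (?B \<union> ?C)"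
  proof (rule set_eqI)
    fix \<tau>
    have "a < b \<longleftrightarrow> (a \<noteq> j \<and> b \<noteq> i \<and> a < b) \<or> (a = j \<and> b \<in> {j<..n}) \<or> (b = i \<and> a \<in> {1..<i})"
      if "a \<in> ?S" "b \<in> ?S" for a b
      using that by auto
    from this[of "\<tau> i" "\<tau> j"] have "\<tau> i < \<tau> j \<longleftrightarrow> (\<tau> i \<noteq> j \<and> \<tau> j \<noteq> i \<and> \<tau> i < \<tau> j)
        \<or> (\<tau> i = j \<and> \<tau> j \<in> {j<..n}) \<or> (\<tau> j = i \<and> \<tau> i \<in> {1..<i})"
      if "\<tau> \<in> derange ?S"
      using derange_in[OF that S(1)] derange_in[OF that S(2)] by satx
    then show "\<tau> \<in> {\<tau> \<in> derange ?S. \<tau> i < \<tau> j} \<longleftrightarrow> \<tau> \<in> ?A \<union> (?B \<union> ?C)"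
      unfolding Un_iff mem_Collect_eq by satx
  qed
  have "card (?A \<union> (?B \<union> ?C)) = card ?A + card (?B \<union> ?C)"
  proof (rule card_Un_disjoint)
    show "finite ?A" "finite (?B \<union> ?C)"
      by (intro finite_UnI finite_subset[OF Collect_restrict fin])+
    show "?A \<inter> (?B \<union> ?C) = {}"
    proof (rule equals0I)
      fix \<tau> assume *: "\<tau> \<in> ?A \<inter> (?B \<union> ?C)"
      then have "\<tau> i \<noteq> j" "\<tau> j \<noteq> i" by simp_all
      moreover from * have "\<tau> i = j \<or> \<tau> j = i" by (elim IntE UnE CollectE) simp_all
      ultimately show False by satx
    qed
  qed
  moreover have "card (?B \<union> ?C) = card ?B + card ?C"
  proof (rule card_Un_disjoint)
    show "finite ?B" "finite ?C"
      by (rule finite_subset[OF Collect_restrict fin])+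
    show "?B \<inter> ?C = {}"
    proof (rule equals0I)
      fix \<tau> assume *: "\<tau> \<in> ?B \<inter> ?C"
      then have "\<tau> j \<in> {j<..n}" by simp
      moreover from * have "\<tau> j = i" by simp
      ultimately have "i \<in> {j<..n}" by metis
      then show False using \<open>i < j\<close> by simp
    qed
  qed
  ultimately have 1: "card {\<tau> \<in> derange ?S. \<tau> i < \<tau> j} = card ?A + (card ?B + card ?C)"
    by (simp only: split)
  \<comment> \<open>Each exceptional event has
    \<open>subfactorial (n - 1) + subfactorial (n - 2)\<close> members, and their intersection has
    \<open>subfactorial (n - 2)\<close>.\<close>
  have "2 * card ?A + 2 * (subfactorial (n - 1) + subfactorial (n - 2))
      = subfactorial n + subfactorial (n - 2)"
    using card_derange_swap[OF S(5) S(1-3)] card_derange_avoid[OF S(5) S(1-3)]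
      card_derange_value_rec[OF S(5) S(1-3)] card_derange_value_rec[OF S(5) S(2,1,4)] c
    by (simp add: card_derange insert_commute)
  from arg_cong[OF this, of real]
  have "2 * real (card ?A) + 2 * (real (subfactorial (n - 1)) + real (subfactorial (n - 2)))
      = real (subfactorial n) + real (subfactorial (n - 2))"
    by (simp only: of_nat_add of_nat_mult of_nat_numeral)
  moreover have "a = (d - c) / 2 - b" if "2 * a + 2 * (b + c) = d + c" for a b c d :: real
    using that by (simp add: field_simps)
  ultimately have A: "real (card ?A) =
      (real (subfactorial n) - real (subfactorial (n - 2))) / 2 - real (subfactorial (n - 1))"
    by blast
  have BC: "{j<..n} \<subseteq> ?S - {i, j}" "{1..<i} \<subseteq> ?S - {j, i}"
    using assms by auto
  have B: "(n - 2) * card ?B = (n - j) * subfactorial (n - 1)"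
    using card_derange_path_set[OF S(5) S(1-3) BC(1)] by simp
  have C: "(n - 2) * card ?C = (i - 1) * subfactorial (n - 1)"
    using card_derange_path_set[OF S(5) S(2,1,4) BC(2)] by simp
  have B': "(real n - 2) * card ?B = (real n - real j) * subfactorial (n - 1)"
    using arg_cong[OF B, of real] assms by (simp add: of_nat_diff)
  have C': "(real n - 2) * card ?C = (real i - 1) * subfactorial (n - 1)"
    using arg_cong[OF C, of real] assms by (simp add: of_nat_diff)
  have n2: "real n - 2 \<noteq> 0"
    using assms by simp
  have B'': "real (card ?B) = (real n - real j) * subfactorial (n - 1) / (real n - 2)"
    using B' n2 by (simp add: eq_divide_eq mult.commute)
  have C'': "real (card ?C) = (real i - 1) * subfactorial (n - 1) / (real n - 2)"
    using C' n2 by (simp add: eq_divide_eq mult.commute)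
  \<comment> \<open>Writing \<open>(n - j) + (i - 1)\<close> as
    \<open>(n - 2) + (1 - (j - i))\<close>, the summand \<open>n - 2\<close> cancels the term
    \<open>- subfactorial (n - 1)\<close> from \<open>?A\<close>.\<close>
  show ?thesis
    unfolding 1 of_nat_add A B'' C'' using n2
    by (simp add: divide_simps) (simp add: algebra_simps)
qed

section \<open>Size of the correction ratio and exact probabilities\<close>

lemma inv_bij_betw_derange: "bij_betw inv (derange S) (derange S)"
  by (rule bij_betw_byWitness[where f' = inv])
    (auto simp: derange_inv dest: derange_permutes permutes_inv_inv)

lemma derangements_eq: "derangements n = derange {1..n}"
  by (simp add: derangements_def derange_def)

text \<open>Factorials obey the same two-term recurrence, so the bound propagates from the arguments
  2 and 3. The constant 3 gives equality at 3. The argument 1 is excluded, where the derangement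
  number vanishes, so 3 is checked directly.\<close>

lemma fact_le_subfactorial: "n \<ge> 2 \<Longrightarrow> fact n \<le> 3 * real (subfactorial n)"
proof (induction n rule: subfactorial.induct)
  case (3 n)
  show ?case
  proof (cases "n \<ge> 2")
    case True
    have "fact (Suc (Suc n)) = real (Suc n) * (fact (Suc n) + fact n)"
      by (simp add: algebra_simps)
    also have "\<dots> \<le> real (Suc n) * (3 * subfactorial (Suc n) + 3 * subfactorial n)"
      using 3 True by (intro mult_left_mono add_mono) auto
    also have "\<dots> = 3 * real (subfactorial (Suc (Suc n)))"
      by (simp add: algebra_simps)
    finally show ?thesis .
  next
    case False
    then have "n = 0 \<or> n = 1" by linarith
    then show ?thesis
      by (auto simp: eval_nat_numeral)
  qed
qed auto

lemma subfactorial_pos: "n \<ge> 2 \<Longrightarrow> real (subfactorial n) > 0"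
  using fact_le_subfactorial[of n] fact_gt_zero[of n, where 'a = real] by linarith

lemma abs_derangement_ratio_le:
  assumes "n \<ge> 2"
  shows "\<bar>derangement_ratio n\<bar> \<le> 3 / fact n"
proof -
  have "\<bar>derangement_ratio n\<bar> = 1 / subfactorial n"
    by (simp add: derangement_ratio_eq abs_divide power_abs)
  also have "\<dots> \<le> 3 / fact n"
    using fact_le_subfactorial[OF assms] subfactorial_pos[OF assms] by (simp add: field_simps)
  finally show ?thesis .
qed

text \<open>With \<open>r = (-1) ^ n / subfactorial n\<close>, the one-term recurrence expresses
  \<open>subfactorial (n - 1)\<close> through \<open>subfactorial n\<close> and \<open>r\<close>,
  and the two-term recurrence then does so for \<open>subfactorial (n - 2)\<close>. Dividing by
  \<open>subfactorial n\<close> leaves an identity of rational functions.\<close>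

lemma card_derange_less_ratio:
  assumes "1 \<le> i" "i < j" "j \<le> n" "n \<ge> 3"
  shows "real (card {\<tau> \<in> derange {1..n}. \<tau> i < \<tau> j}) / subfactorial n =
    1 / 2 + ((1 - 2 * (real j - real i)) * real n + 2 * (real j - real i))
        / (2 * real n * (real n - 1) * (real n - 2))
      + derangement_ratio n * ((2 * (real j - real i) - real n) / (2 * real n * (real n - 2)))"
proof -
  define r where "r = derangement_ratio n"
  define d where "d = real j - real i"
  define x where "x = real n"
  let ?D = "real (subfactorial n)"
  obtain m where m: "n = Suc (Suc m)"
    using assms(4) by (intro that[of "n - 2"]) linarith
  have D: "?D > 0"
    using assms(4) by (intro subfactorial_pos) simp
  have x: "x > 0" "x - 1 > 0" "x - 2 > 0"
    using assms(4) by (auto simp: x_def)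
  have "(-1) ^ n = r * ?D"
    using D by (simp add: r_def derangement_ratio_eq)
  moreover have "?D = x * real (subfactorial (n - 1)) + (-1) ^ n"
    using subfactorial_Suc[of "Suc m"] by (simp add: m x_def del: subfactorial.simps)
  ultimately have 1: "real (subfactorial (n - 1)) = ?D * (1 - r) / x"
    using x by (simp add: field_simps)
  have "?D = (x - 1) * (real (subfactorial (n - 1)) + real (subfactorial (n - 2)))"
    by (simp add: m x_def algebra_simps)
  then have "real (subfactorial (n - 2)) = ?D / (x - 1) - real (subfactorial (n - 1))"
    using x by (simp add: field_simps)
  then have 2: "real (subfactorial (n - 2)) = ?D / (x - 1) - ?D * (1 - r) / x"
    unfolding 1 .
  have "real (card {\<tau> \<in> derange {1..n}. \<tau> i < \<tau> j}) / ?D =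
      (1 - 1 / (x - 1) + (1 - r) / x) / 2 + (1 - d) * (1 - r) / (x * (x - 2))"
    unfolding card_derange_less[OF assms] 1 2 d_def[symmetric] x_def[symmetric]
    using D x by (simp add: add_divide_distrib diff_divide_distrib)
  also have "\<dots> = 1 / 2 + ((1 - 2 * d) * x + 2 * d) / (2 * x * (x - 1) * (x - 2))
      + r * ((2 * d - x) / (2 * x * (x - 2)))"
    using x by (simp add: divide_simps) (simp add: algebra_simps)
  finally show ?thesis
    by (simp add: r_def d_def x_def)
qed

text \<open>Inversion maps derangements bijectively to derangements and turns the order of positions
  into the order of values.\<close>

lemma prob_inv_less:
  assumes "n \<ge> 2"
  shows "measure_pmf.prob (derangement_pmf n) {\<sigma>. inv \<sigma> i < inv \<sigma> j} =
    real (card {\<tau> \<in> derange {1..n}. \<tau> i < \<tau> j}) / subfactorial n"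
proof -
  have c: "card (derange {1..n}) = subfactorial n"
    by (simp add: card_derange)
  \<comment> \<open>Nonemptiness is what makes \<open>pmf_of_set\<close> the uniform distribution
    here.\<close>
  then have "derange {1..n} \<noteq> {}"
    using subfactorial_pos[OF assms] by auto
  then have "measure_pmf.prob (derangement_pmf n) {\<sigma>. inv \<sigma> i < inv \<sigma> j} =
      real (card (derange {1..n} \<inter> {\<sigma>. inv \<sigma> i < inv \<sigma> j})) / subfactorial n"
    by (simp add: derangement_pmf_def derangements_eq measure_pmf_of_set finite_derange c del: One_nat_def)
  also have "card (derange {1..n} \<inter> {\<sigma>. inv \<sigma> i < inv \<sigma> j}) = card {\<tau> \<in> derange {1..n}. \<tau> i < \<tau> j}"
  proof (rule bij_betw_same_card)
    show "bij_betw inv (derange {1..n} \<inter> {\<sigma>. inv \<sigma> i < inv \<sigma> j}) {\<tau> \<in> derange {1..n}. \<tau> i < \<tau> j}"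
      by (rule bij_betw_byWitness[where f' = inv])
        (auto simp: derange_inv permutes_inv_inv[OF derange_permutes])
  qed
  finally show ?thesis .
qed

section \<open>Expected number of inversions\<close>

lemma sum_pairs:
  "(\<Sum>(i, j)\<in>{(i, j). 1 \<le> i \<and> i < j \<and> j \<le> n}. g i j) = (\<Sum>j = 1..n. \<Sum>i = 1..<j. g i j)"
  for n :: nat and g :: "nat \<Rightarrow> nat \<Rightarrow> 'a :: comm_monoid_add"
proof -
  have "(\<Sum>j = 1..n. \<Sum>i = 1..<j. g i j) = (\<Sum>(j, i)\<in>(SIGMA j:{1..n}. {1..<j}). g i j)"
    by (rule sum.Sigma) auto
  also have "\<dots> = (\<Sum>(i, j)\<in>{(i, j). 1 \<le> i \<and> i < j \<and> j \<le> n}. g i j)"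
    by (rule sum.reindex_bij_witness[where i = prod.swap and j = prod.swap]) auto
  finally show ?thesis ..
qed

text \<open>The two factors are the number of pairs and the sum of all distances, which is the
  binomial coefficient of n+1 over 3.\<close>

lemma sum_affine_distance:
  "(\<Sum>j = 1..n. \<Sum>i = 1..<j. a + b * (real j - real i)) =
    a * (real n * (real n - 1) / 2) + b * ((real n + 1) * real n * (real n - 1) / 6)"
proof (induction n)
  case (Suc n)
  \<comment> \<open>The inner sum keeps \<open>c\<close> apart from the upper limit so that
    induction on \<open>m\<close> leaves it fixed; it is then used for the new outer index
    \<open>Suc n\<close>.\<close>
  have "(\<Sum>i = 1..<Suc m. a + b * (c - real i)) = real m * (a + b * c) - b * (real m * (real m + 1) / 2)"
    for m :: nat and c :: real
    by (induction m) (auto simp: field_simps)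
  from this[where m = n and c = "real (Suc n)"] Suc show ?case
    by (simp add: field_simps)
qed simp

text \<open>By linearity this is the sum over pairs of the inversion probabilities, each the
  complement of the probability that \<open>\<sigma> i < \<sigma> j\<close>. These are affine in
  \<open>j - i\<close>, so only the number of pairs and the sum of distances enter.\<close>

lemma expectation_inversions:
  assumes "n \<ge> 3"
  shows "measure_pmf.expectation (derangement_pmf n) (\<lambda>\<sigma>. real (inversions n \<sigma>)) =
    real n * (real n - 1) / 4 + real n / 6 + 1 / 12 + derangement_ratio n * ((real n - 1) / 12)"
proof -
  define r where "r = derangement_ratio n"
  define x where "x = real n"
  let ?S = "derange {1..n}"
  let ?D = "real (subfactorial n)"
  let ?P = "{(i, j). 1 \<le> i \<and> i < j \<and> j \<le> n}"
  have D: "?D > 0"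
    using assms by (intro subfactorial_pos) simp
  have x: "x > 0" "x - 1 > 0" "x - 2 > 0"
    using assms by (auto simp: x_def)
  have c: "card ?S = subfactorial n"
    by (simp add: card_derange)
  then have "?S \<noteq> {}"
    using D by auto
  then have "measure_pmf.expectation (derangement_pmf n) (\<lambda>\<sigma>. real (inversions n \<sigma>)) =
      (\<Sum>\<sigma>\<in>?S. real (inversions n \<sigma>)) / ?D"
    by (simp add: derangement_pmf_def derangements_eq integral_pmf_of_set finite_derange c del: One_nat_def)
  also have "(\<Sum>\<sigma>\<in>?S. real (inversions n \<sigma>)) =
      (\<Sum>\<sigma>\<in>?S. \<Sum>(i, j)\<in>?P. of_bool (\<sigma> j < \<sigma> i))"
    by (simp add: inversions_def case_prod_unfold)
  also have "\<dots> = (\<Sum>(i, j)\<in>?P. \<Sum>\<sigma>\<in>?S. of_bool (\<sigma> j < \<sigma> i))"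
    by (subst sum.swap) (simp add: case_prod_unfold)
  also have "\<dots> / ?D = (\<Sum>(i, j)\<in>?P. (\<Sum>\<sigma>\<in>?S. of_bool (\<sigma> j < \<sigma> i)) / ?D)"
    by (simp add: sum_divide_distrib case_prod_unfold)
  \<comment> \<open>The summand is sorted into a constant part and a multiple of
    \<open>j - i\<close>, to fit \<open>sum_affine_distance\<close>.\<close>
  also have "\<dots> = (\<Sum>(i, j)\<in>?P. (1 / 2 - 1 / (2 * (x - 1) * (x - 2)) + r / (2 * (x - 2)))
      + (1 - r) / (x * (x - 2)) * (real j - real i))"
  proof (intro sum.cong refl, clarify)
    fix i j assume ij: "1 \<le> i" "i < j" "j \<le> n"
    define d where "d = real j - real i"
    have "\<sigma> j < \<sigma> i \<longleftrightarrow> \<not> \<sigma> i < \<sigma> j" if "\<sigma> \<in> ?S" for \<sigma>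
      using derange_eq_iff[OF that, of i j] ij by linarith
    then have "(\<Sum>\<sigma>\<in>?S. of_bool (\<sigma> j < \<sigma> i)) = (\<Sum>\<sigma>\<in>?S. 1 - of_bool (\<sigma> i < \<sigma> j) :: real)"
      by (intro sum.cong) auto
    also have "\<dots> = ?D - card {\<tau> \<in> ?S. \<tau> i < \<tau> j}"
      by (simp add: sum_subtractf c finite_derange Int_def del: One_nat_def)
    finally have "(\<Sum>\<sigma>\<in>?S. of_bool (\<sigma> j < \<sigma> i)) / ?D = 1 - card {\<tau> \<in> ?S. \<tau> i < \<tau> j} / ?D"
      using D by (simp add: diff_divide_distrib)
    also have "\<dots> = 1 - (1 / 2 + ((1 - 2 * d) * x + 2 * d) / (2 * x * (x - 1) * (x - 2))
      + r * ((2 * d - x) / (2 * x * (x - 2))))"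
      unfolding card_derange_less_ratio[OF ij assms] by (simp only: r_def d_def x_def)
    also have "\<dots> = (1 / 2 - 1 / (2 * (x - 1) * (x - 2)) + r / (2 * (x - 2)))
      + (1 - r) / (x * (x - 2)) * d"
      using x by (simp add: divide_simps) (simp add: algebra_simps)
    finally show "(\<Sum>\<sigma>\<in>?S. of_bool (\<sigma> j < \<sigma> i)) / ?D =
      (1 / 2 - 1 / (2 * (x - 1) * (x - 2)) + r / (2 * (x - 2)))
      + (1 - r) / (x * (x - 2)) * (real j - real i)"
      by (simp only: d_def)
  qed
  also have "\<dots> = (1 / 2 - 1 / (2 * (x - 1) * (x - 2)) + r / (2 * (x - 2))) * (x * (x - 1) / 2)
      + (1 - r) / (x * (x - 2)) * ((x + 1) * x * (x - 1) / 6)"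
    unfolding sum_pairs sum_affine_distance x_def ..
  \<comment> \<open>The denominator \<open>x - 2\<close> cancels: the corrections have numerators
    \<open>2 * x^2 - 3 * x - 2 = (2 * x + 1) * (x - 2)\<close> and, for \<open>r\<close>,
    \<open>(x - 1) * (3 * x - 2 * (x + 1))\<close>, both over \<open>12 * (x - 2)\<close>.\<close>
  also have "\<dots> = x * (x - 1) / 4 + x / 6 + 1 / 12 + r * ((x - 1) / 12)"
    using x by (simp add: divide_simps) (simp add: algebra_simps)
  finally show ?thesis
    by (simp only: r_def x_def)
qed

theorem theorem1:
  shows "\<exists>C::real. C > 0 \<and> (\<forall>n::nat. n \<ge> 3 \<longrightarrow>
    (measure_pmf.expectation (derangement_pmf n) (\<lambda>\<sigma>. real (inversions n \<sigma>)) =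
       real n * (real n - 1) / 4 + real n / 6 + 1 / 12 + derangement_ratio n * ((real n - 1) / 12)
     \<and> \<bar>measure_pmf.expectation (derangement_pmf n) (\<lambda>\<sigma>. real (inversions n \<sigma>))
         - real n * (real n - 1) / 4 - real n / 6 - 1 / 12\<bar> \<le> C / fact (n - 1))
    \<and> (\<forall>i j::nat. 1 \<le> i \<and> i < j \<and> j \<le> n \<longrightarrow>
       measure_pmf.prob (derangement_pmf n) {\<sigma>. inv \<sigma> i < inv \<sigma> j} =
         1 / 2
         + ((1 - 2 * (real j - real i)) * real n + 2 * (real j - real i))
             / (2 * real n * (real n - 1) * (real n - 2))
         + derangement_ratio n * ((2 * (real j - real i) - real n) / (2 * real n * (real n - 2)))
       \<and> \<bar>measure_pmf.prob (derangement_pmf n) {\<sigma>. inv \<sigma> i < inv \<sigma> j} - 1 / 2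
           - ((1 - 2 * (real j - real i)) * real n + 2 * (real j - real i))
               / (2 * real n * (real n - 1) * (real n - 2))\<bar> \<le> C / fact (n + 1)))"
proof (intro exI[of _ 6] conjI allI impI)
  fix n :: nat assume n: "n \<ge> 3"
  let ?E = "measure_pmf.expectation (derangement_pmf n) (\<lambda>\<sigma>. real (inversions n \<sigma>))"
  have r: "\<bar>derangement_ratio n\<bar> \<le> 3 / fact n"
    using n by (intro abs_derangement_ratio_le) simp
  show E: "?E = real n * (real n - 1) / 4 + real n / 6 + 1 / 12 + derangement_ratio n * ((real n - 1) / 12)"
    using n by (rule expectation_inversions)
  have "\<bar>?E - real n * (real n - 1) / 4 - real n / 6 - 1 / 12\<bar> = \<bar>derangement_ratio n\<bar> * ((real n - 1) / 12)"
    using n unfolding E by (simp add: abs_mult)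
  also have "\<dots> \<le> 3 / fact n * real n"
    using n r by (intro mult_mono) auto
  also have "\<dots> = 3 / fact (n - 1)"
    using n by (simp add: fact_reduce[of n])
  \<comment> \<open>The bound for the expectation holds with 3; the common constant 6 comes from the
    bound for the probabilities.\<close>
  also have "\<dots> \<le> 6 / fact (n - 1)"
    by (intro divide_right_mono) auto
  finally show "\<bar>?E - real n * (real n - 1) / 4 - real n / 6 - 1 / 12\<bar> \<le> 6 / fact (n - 1)" .
  fix i j :: nat assume "1 \<le> i \<and> i < j \<and> j \<le> n"
  then have ij: "1 \<le> i" "i < j" "j \<le> n" by auto
  let ?d = "real j - real i"
  let ?p = "measure_pmf.prob (derangement_pmf n) {\<sigma>. inv \<sigma> i < inv \<sigma> j}"
  let ?q = "((1 - 2 * ?d) * real n + 2 * ?d) / (2 * real n * (real n - 1) * (real n - 2))"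
  show p: "?p = 1 / 2 + ?q + derangement_ratio n * ((2 * ?d - real n) / (2 * real n * (real n - 2)))"
    using card_derange_less_ratio[OF ij n] prob_inv_less[of n i j] n by simp
  have "\<bar>?p - 1 / 2 - ?q\<bar> = \<bar>derangement_ratio n\<bar> * (\<bar>2 * ?d - real n\<bar> / (2 * real n * (real n - 2)))"
    using n unfolding p by (simp add: abs_mult)
  \<comment> \<open>Since \<open>j - i\<close> lies between 1 and \<open>n - 1\<close>, the absolute
    value of \<open>2 * (j - i) - n\<close> is at most \<open>n\<close>.\<close>
  also have "\<dots> \<le> 3 / fact n * (real n / (2 * real n * (real n - 2)))"
    using n r ij by (intro mult_mono divide_right_mono) auto
  also have "real n / (2 * real n * (real n - 2)) = 1 / (2 * (real n - 2))"
    using n by simp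
  \<comment> \<open>This amounts to \<open>n + 1 \<le> 4 * (n - 2)\<close>, that is
    \<open>n \<ge> 3\<close>. It supplies the factor that raises \<open>fact n\<close> to
    \<open>fact (n + 1)\<close>.\<close>
  also have "\<dots> \<le> 2 / (real n + 1)"
    using n by (simp add: divide_simps)
  then have "3 / fact n * (1 / (2 * (real n - 2))) \<le> 3 / fact n * (2 / (real n + 1))"
    by (intro mult_left_mono) auto
  also have "3 / fact n * (2 / (real n + 1)) = 6 / fact (n + 1)"
    by (simp add: field_simps)
  finally show "\<bar>?p - 1 / 2 - ?q\<bar> \<le> 6 / fact (n + 1)" .
qed simp

end
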